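(* Let $m,n\ge 2$ and $t\ge 3$. Let $G$ be a graph of order $2m$ that admits a local antimagic $t$-coloring $f$. Suppose that (i) the $t$ color classes of $f$ can be split into two groups whose unions $V_1$ and $V_2$ satisfy $|V_1|=|V_2|=m$; (ii) there are no integers $a,b$ such that $a$ and $b+1$ are induced colors (values of $f^+$) of vertices in $V_1$ while $a+1$ and $b$ are induced colors of vertices in $V_2$; and (iii) $2n-1>2m$, or else $m\ge n^2-\frac{3(n-1)}{2}$. Then $\chi_{la}(G\vee O_{2n-1})\le t+1$, with equality if $\chi(G)=t$.
   Context: For a simple graph with $q$ edges, a bijection $f:E\to\{1,\dots,q\}$ is a local antimagic labeling if $f^+(u)\neq f^+(v)$ for every edge $uv$, where $f^+(u)=\sum_{e\ni u} f(e)$; the value $f^+(u)$ is the induced color of $u$, and if exactly $t$ distinct colors occur $f$ is a local antimagic $t$-coloring; a color class is the set of vertices with a given induced color. $\chi_{la}$ is the minimum number of distinct induced colors over all local antimagic labelings; $\chi$ is the chromatic number. $O_n$ is the edgeless graph on $n$ vertices, and the join $G\vee H$ of vertex-disjoint graphs has vertex set $V(G)\cup V(H)$ and edge set $E(G)\cup E(H)\cup\{uv:u\in V(G),v\in V(H)\}$. *)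

theory Defs
  imports Complex_Main "HOL-Library.Extended_Nat"
begin

record 'a ugraph =
  verts :: "'a set"
  edges :: "'a set set"

definition simple_graph :: "'a ugraph \<Rightarrow> bool" where
  "simple_graph G \<longleftrightarrow> finite (verts G) \<and> (\<forall>e\<in>edges G. e \<subseteq> verts G \<and> card e = 2)"

definition edgeless :: "'a set \<Rightarrow> 'a ugraph" where
  "edgeless W = \<lparr>verts = W, edges = {}\<rparr>"

text \<open>Meaningful as a graph join only when the two vertex sets are disjoint.\<close>

definition graph_join :: "'a ugraph \<Rightarrow> 'a ugraph \<Rightarrow> 'a ugraph" where
  "graph_join G H =
    \<lparr>verts = verts G \<union> verts H,
     edges = edges G \<union> edges H \<union> {{u, v} | u v. u \<in> verts G \<and> v \<in> verts H}\<rparr>"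

definition induced_color :: "'a ugraph \<Rightarrow> ('a set \<Rightarrow> nat) \<Rightarrow> 'a \<Rightarrow> nat" where
  "induced_color G f u = (\<Sum>e | e \<in> edges G \<and> u \<in> e. f e)"

definition local_antimagic_labeling :: "'a ugraph \<Rightarrow> ('a set \<Rightarrow> nat) \<Rightarrow> bool" where
  "local_antimagic_labeling G f \<longleftrightarrow>
    bij_betw f (edges G) {1..card (edges G)} \<and>
    (\<forall>u v. {u, v} \<in> edges G \<longrightarrow> induced_color G f u \<noteq> induced_color G f v)"

definition induced_colors :: "'a ugraph \<Rightarrow> ('a set \<Rightarrow> nat) \<Rightarrow> nat set" where
  "induced_colors G f = induced_color G f ` verts G"

definition local_antimagic_coloring :: "'a ugraph \<Rightarrow> nat \<Rightarrow> ('a set \<Rightarrow> nat) \<Rightarrow> bool" where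
  "local_antimagic_coloring G t f \<longleftrightarrow>
    local_antimagic_labeling G f \<and> card (induced_colors G f) = t"

definition color_class :: "'a ugraph \<Rightarrow> ('a set \<Rightarrow> nat) \<Rightarrow> nat \<Rightarrow> 'a set" where
  "color_class G f c = {v \<in> verts G. induced_color G f v = c}"

definition color_classes :: "'a ugraph \<Rightarrow> ('a set \<Rightarrow> nat) \<Rightarrow> 'a set set" where
  "color_classes G f = color_class G f ` induced_colors G f"

text \<open>The value is \<open>\<infinity>\<close> when no local antimagic labeling exists, so a finite upper bound
  includes the existence of one.\<close>

definition chi_la :: "'a ugraph \<Rightarrow> enat" where
  "chi_la G = (INF f \<in> {f. local_antimagic_labeling G f}. enat (card (induced_colors G f)))"

definition proper_coloring :: "'a ugraph \<Rightarrow> nat \<Rightarrow> ('a \<Rightarrow> nat) \<Rightarrow> bool" where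
  "proper_coloring G k c \<longleftrightarrow>
    c ` verts G \<subseteq> {..<k} \<and> (\<forall>u v. {u, v} \<in> edges G \<longrightarrow> c u \<noteq> c v)"

definition chromatic_number :: "'a ugraph \<Rightarrow> nat" where
  "chromatic_number G = (LEAST k. \<exists>c. proper_coloring G k c)"

lemma simple_graph_edgeless: "finite W \<Longrightarrow> simple_graph (edgeless W)"
  by (simp add: simple_graph_def edgeless_def)

lemma simple_graph_join:
  assumes "simple_graph G" "simple_graph H" "verts G \<inter> verts H = {}"
  shows "simple_graph (graph_join G H)"
proof -
  have "card {u, v} = 2" if "u \<in> verts G" "v \<in> verts H" for u v
    using that assms(3) by (metis card_2_iff disjoint_iff)
  with assms(1,2) show ?thesis
    by (auto simp: simple_graph_def graph_join_def)
qed

end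

theory Submission
  imports Defs
begin

text \<open>
  Label the edges between \<open>G\<close> and the \<open>2n - 1\<close> new vertices by \<open>q\<close> plus the entries of a
  \<open>2m \<times> (2n - 1)\<close> array filled with \<open>1, \<dots>, 2K\<close>, \<open>K = m(2n - 1)\<close>, whose columns have equal
  sums and whose rows have a common sum on one half of the vertices of \<open>G\<close> and a sum larger by one
  on the other half. The rows come in pairs with entries \<open>K + g\<close> and \<open>K + 1 - g\<close>,
  which makes all column sums equal; the integers \<open>g\<close> in each of the \<open>m\<close> row pairs must sum to \<open>n\<close>,
  and \<open>max g (1 - g)\<close> must run through \<open>1, \<dots>, K\<close>. For \<open>n = 2\<close> this
  is a partition of \<open>1, \<dots>, 3m\<close> into triples with \<open>a + b = c\<close> or \<open>a + b = c + 1\<close>, and \<open>n\<close> is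
  increased by appending to each row two entries of opposite sign with consecutive \<open>max g (1 - g)\<close>.
  Condition (ii) allows choosing which of \<open>V1\<close>, \<open>V2\<close> receives the larger row sums without
  creating a conflict inside \<open>G\<close>; condition (iii) separates the colors of \<open>G\<close> from the
  single color of the new vertices, since a vertex of degree \<open>d\<close> has color at most
  \<open>d(2q + 1 - d)/2\<close>.
\<close>

section \<open>Signed rows with constant sum\<close>

text \<open>
  The triple of row \<open>i\<close> is \<open>a = i + 1\<close> together with \<open>b < c\<close> from \<open>m + 1, \<dots>, 3m\<close> at distance
  \<open>2 (i div 2) + 1\<close>, which is \<open>a\<close> or \<open>a - 1\<close>. The pairs \<open>b, c\<close> form two nests of concentric
  pairs, one for even and one for odd \<open>i\<close>, with \<open>A\<close> and \<open>B\<close> pairs.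
\<close>

lemma signed_triples_exist:
  "\<exists>g :: nat \<Rightarrow> nat \<Rightarrow> int. (\<forall>i<m. (\<Sum>j<3. g i j) = 2) \<and>
     bij_betw (\<lambda>(i, j). max (g i j) (1 - g i j)) ({..<m} \<times> {..<3}) {1..int (m * 3)}"
proof -
  define A B where "A = int ((m + 1) div 2)" and "B = int (m div 2)"
  \<comment> \<open>An entry with \<open>max g (1 - g) = x\<close> is \<open>x\<close> or
    \<open>1 - x\<close>. For even \<open>i\<close> the triple has \<open>c = a + b\<close> and the
    row is \<open>1 - a, 1 - b, c\<close>; for odd \<open>i\<close> it has
    \<open>c = a + b - 1\<close> and the row is \<open>a, b, 1 - c\<close>. Both sum to 2.\<close>
  define g :: "nat \<Rightarrow> nat \<Rightarrow> int" where "g i j =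
    (let k = int (i div 2) in
     if even i then
       (if j = 0 then - int i else if j = 1 then 1 - (int m + A - k) else int m + A + k + 1)
     else
       (if j = 0 then int i + 1 else if j = 1 then int m + 2 * A + B - k
        else - (int m + 2 * A + B + k)))" for i j
  define h where "h i j = max (g i j) (1 - g i j)" for i j
  have AB: "A + B = int m" "B \<le> A" "A \<le> B + 1"
    unfolding A_def B_def by linarith+
  have k_even: "int i = 2 * int (i div 2)" "int (i div 2) < A" if "i < m" "even i" for i
    using that unfolding A_def by (auto elim!: evenE)
  have k_odd: "int i = 2 * int (i div 2) + 1" "int (i div 2) < B" if "i < m" "odd i" for i
    using that unfolding B_def by (auto elim!: oddE)
  have h: "h i j = (let k = int (i div 2) in
      if j = 0 then int i + 1
      else if even i then (if j = 1 then int m + A - k else int m + A + k + 1)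
      else (if j = 1 then int m + 2 * A + B - k else int m + 2 * A + B + k + 1))"
    if "i < m" for i j
    using k_even[OF that] k_odd[OF that] AB unfolding h_def g_def Let_def
    by (auto simp: max_def)
  have sums: "(\<Sum>j<3. g i j) = 2" if "i < m" for i
    using k_even[OF that] k_odd[OF that] AB
    by (auto simp: g_def Let_def numeral_3_eq_3)
  have h_cases: "(\<exists>k. int i = 2 * k \<and> 0 \<le> k \<and> k < A \<and>
      (j = 0 \<and> h i j = 2 * k + 1 \<or> j = 1 \<and> h i j = int m + A - k \<or> j = 2 \<and> h i j = int m + A + k + 1)) \<or>
    (\<exists>k. int i = 2 * k + 1 \<and> 0 \<le> k \<and> k < B \<and>
      (j = 0 \<and> h i j = 2 * k + 2 \<or> j = 1 \<and> h i j = int m + 2 * A + B - k \<or>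
       j = 2 \<and> h i j = int m + 2 * A + B + k + 1))" (is "?even \<or> ?odd")
    if "i < m" "j < 3" for i j
  proof -
    have j: "j = 0 \<or> j = 1 \<or> j = 2" using that by auto
    show ?thesis
    proof (cases "even i")
      case True
      have ?even
        by (rule exI[of _ "int (i div 2)"])
          (use j k_even[OF that(1) True] True in \<open>auto simp: h[OF that(1)] Let_def\<close>)
      then show ?thesis ..
    next
      case False
      have ?odd
        by (rule exI[of _ "int (i div 2)"])
          (use j k_odd[OF that(1) False] False in \<open>auto simp: h[OF that(1)] Let_def\<close>)
      then show ?thesis ..
    qed
  qed
  \<comment> \<open>An explicit left inverse of \<open>h\<close>. The five ranges are the values
    \<open>a\<close>, then the left and right halves of the even nest, then those of the odd nest.
    Surjectivity follows by counting.\<close>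
  define decode :: "int \<Rightarrow> nat \<times> nat" where "decode x =
    (if x \<le> int m then (nat (x - 1), 0)
     else if x \<le> int m + A then (nat (2 * (int m + A - x)), 1)
     else if x \<le> int m + 2 * A then (nat (2 * (x - int m - A - 1)), 2)
     else if x \<le> int m + 2 * A + B then (nat (2 * (int m + 2 * A + B - x) + 1), 1)
     else (nat (2 * (x - int m - 2 * A - B - 1) + 1), 2))" for x
  have inj: "inj_on (\<lambda>(i, j). h i j) ({..<m} \<times> {..<3})"
  proof (rule inj_on_inverseI, clarsimp)
    fix i j :: nat
    assume "i < m" "j < 3"
    from h_cases[OF this] show "decode (h i j) = (i, j)"
      using AB by (elim disjE exE conjE) (simp_all add: decode_def)
  qed
  have img: "(\<lambda>(i, j). h i j) ` ({..<m} \<times> {..<3}) \<subseteq> {1..int (m * 3)}"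
  proof (clarsimp)
    fix i j :: nat
    assume *: "i < m" "j < 3"
    then show "1 \<le> h i j \<and> h i j \<le> int m * 3"
      using h_cases[OF *] AB by (elim disjE exE conjE; simp)
  qed
  have "bij_betw (\<lambda>(i, j). h i j) ({..<m} \<times> {..<3}) {1..int (m * 3)}"
    unfolding bij_betw_def using inj img
    by (intro conjI card_subset_eq) (auto simp: card_image)
  then show ?thesis using sums unfolding h_def by (intro exI[of _ g]) simp
qed

text \<open>Why the sum is \<open>n\<close>: replacing each \<open>g\<close> by \<open>1 - g\<close>
  turns the row sum into \<open>n - 1\<close>, so complementary rows of odd length
  \<open>2 * n - 1\<close> come as close as possible, at distance one.\<close>

lemma signed_rows_exist:
  assumes "n \<ge> 2"
  shows "\<exists>g :: nat \<Rightarrow> nat \<Rightarrow> int. (\<forall>i<m. (\<Sum>j<2 * n - 1. g i j) = int n) \<and>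
     bij_betw (\<lambda>(i, j). max (g i j) (1 - g i j)) ({..<m} \<times> {..<2 * n - 1}) {1..int (m * (2 * n - 1))}"
  using assms
proof (induction n rule: dec_induct)
  case base
  then show ?case using signed_triples_exist[of m] by simp
next
  case (step n)
  define c where "c = 2 * n - 1"
  have c: "2 * Suc n - 1 = Suc (Suc c)" "int c = 2 * int n - 1" using step unfolding c_def by auto
  define K where "K = int (m * c)"
  from step.IH obtain g :: "nat \<Rightarrow> nat \<Rightarrow> int" where
    g: "\<And>i. i < m \<Longrightarrow> (\<Sum>j<c. g i j) = int n"
    and bij: "bij_betw (\<lambda>(i, j). max (g i j) (1 - g i j)) ({..<m} \<times> {..<c}) {1..K}"
    unfolding c_def K_def by blast
  \<comment> \<open>Appending the two new entries alone changes the row sum by 0 or 2 instead of 1; replacing the old entries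
    \<open>g\<close> by \<open>1 - g\<close> corrects this.\<close>
  define g' :: "nat \<Rightarrow> nat \<Rightarrow> int" where "g' i j =
    (if j < c then 1 - g i j else if j = c then K + 2 * int i + 2 else - (K + 2 * int i))" for i j
  define h where "h = (\<lambda>(i, j). max (g' i j) (1 - g' i j))"
  have K0: "0 \<le> K" unfolding K_def by simp
  have sums: "(\<Sum>j<Suc (Suc c). g' i j) = int (Suc n)" if "i < m" for i
    using g[OF that] c(2) by (simp add: g'_def sum_subtractf)
  \<comment> \<open>\<open>max g (1 - g)\<close> is invariant under exchanging \<open>g\<close> and
    \<open>1 - g\<close>.\<close>
  have bij_old: "bij_betw h ({..<m} \<times> {..<c}) {1..K}"
    using bij by (rule bij_betw_cong[THEN iffD1, rotated]) (auto simp: h_def g'_def)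
  have h_new: "h (i, c) = K + 2 * int i + 2" "h (i, Suc c) = K + 2 * int i + 1" for i
    using K0 by (auto simp: h_def g'_def)
  have bij_new: "bij_betw h ({..<m} \<times> {c, Suc c}) {K + 1..K + 2 * int m}"
  proof -
    have "inj_on h ({..<m} \<times> {c, Suc c})"
      by (rule inj_onI) (auto simp: h_new, presburger+)
    moreover have "h ` ({..<m} \<times> {c, Suc c}) \<subseteq> {K + 1..K + 2 * int m}"
      by (auto simp: h_new)
    ultimately show ?thesis
      unfolding bij_betw_def
      by (intro conjI card_subset_eq) (auto simp: card_image)
  qed
  have "bij_betw h ({..<m} \<times> {..<c} \<union> {..<m} \<times> {c, Suc c}) ({1..K} \<union> {K + 1..K + 2 * int m})"
    using bij_old bij_new by (rule bij_betw_combine) auto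
  moreover have "{..<m} \<times> {..<c} \<union> {..<m} \<times> {c, Suc c} = {..<m} \<times> {..<Suc (Suc c)}" by auto
  moreover have "{1..K} \<union> {K + 1..K + 2 * int m} = {1..int (m * Suc (Suc c))}"
  proof -
    have "int (m * Suc (Suc c)) = K + 2 * int m" by (simp add: K_def algebra_simps)
    then show ?thesis using K0 by (simp del: of_nat_mult of_nat_Suc add: set_eq_iff) linarith
  qed
  ultimately have "bij_betw h ({..<m} \<times> {..<Suc (Suc c)}) {1..int (m * Suc (Suc c))}" by simp
  then show ?case using sums unfolding c(1) h_def by (intro exI[of _ g']) simp
qed

section \<open>The array of labels for the join edges\<close>

text \<open>A row of \<open>A\<close> and the row of \<open>B\<close> with the same index have
  entries summing to \<open>2 * K + 1\<close> in every column, which gives the column sums. With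
  \<open>c = 2 * n - 1\<close>, the row sums are \<open>K * c + n\<close> and
  \<open>c * (K + 1) - n\<close>, and the latter is \<open>K * c + n - 1\<close>.\<close>

lemma nearly_magic_rectangle:
  fixes A B :: "'a set" and W :: "'b set" and m n :: nat
  assumes "n \<ge> 2" and fin: "finite A" "finite B" "finite W"
    and card: "card A = m" "card B = m" "card W = 2 * n - 1" and disj: "A \<inter> B = {}"
  defines "K \<equiv> m * (2 * n - 1)"
  shows "\<exists>l :: 'a \<Rightarrow> 'b \<Rightarrow> nat. bij_betw (\<lambda>(u, w). l u w) ((A \<union> B) \<times> W) {1..2 * K} \<and>
     (\<forall>u\<in>A. (\<Sum>w\<in>W. l u w) = K * (2 * n - 1) + n) \<and>
     (\<forall>u\<in>B. (\<Sum>w\<in>W. l u w) = K * (2 * n - 1) + n - 1) \<and>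
     (\<forall>w\<in>W. (\<Sum>u\<in>A \<union> B. l u w) = m * (2 * K + 1))"
proof -
  define c where "c = 2 * n - 1"
  have c: "int c = 2 * int n - 1" using assms(1) unfolding c_def by auto
  obtain g :: "nat \<Rightarrow> nat \<Rightarrow> int" where
    g: "\<And>i. i < m \<Longrightarrow> (\<Sum>j<c. g i j) = int n"
    and bij: "bij_betw (\<lambda>(i, j). max (g i j) (1 - g i j)) ({..<m} \<times> {..<c}) {1..int K}"
    using signed_rows_exist[OF assms(1), of m] unfolding K_def c_def by blast
  obtain \<alpha> where \<alpha>: "bij_betw \<alpha> A {..<m}"
    using finite_same_card_bij[OF fin(1), of "{..<m}"] card by auto
  obtain \<beta> where \<beta>: "bij_betw \<beta> B {..<m}"
    using finite_same_card_bij[OF fin(2), of "{..<m}"] card by auto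
  obtain \<omega> where \<omega>: "bij_betw \<omega> W {..<c}"
    using finite_same_card_bij[OF fin(3), of "{..<c}"] card unfolding c_def by auto
  define z where "z u w = (if u \<in> A then int K + g (\<alpha> u) (\<omega> w) else int K + 1 - g (\<beta> u) (\<omega> w))" for u w
  have range: "1 - int K \<le> g i j" "g i j \<le> int K" if "i < m" "j < c" for i j
  proof -
    have "max (g i j) (1 - g i j) \<in> {1..int K}"
      using bij_betw_apply[OF bij, of "(i, j)"] that by simp
    then show "1 - int K \<le> g i j" "g i j \<le> int K" by auto
  qed
  have \<alpha>_lt: "\<alpha> u < m" if "u \<in> A" for u using bij_betw_apply[OF \<alpha> that] by simp
  have \<beta>_lt: "\<beta> u < m" if "u \<in> B" for u using bij_betw_apply[OF \<beta> that] by simp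
  have \<omega>_lt: "\<omega> w < c" if "w \<in> W" for w using bij_betw_apply[OF \<omega> that] by simp
  have z_range: "z u w \<in> {1..int (2 * K)}" if "u \<in> A \<union> B" "w \<in> W" for u w
    using that range[OF \<alpha>_lt \<omega>_lt, of u w] range[OF \<beta>_lt \<omega>_lt, of u w] unfolding z_def by auto
  have g_inj: "i = i' \<and> j = j'"
    \<comment> \<open>Equal labels in rows of the same kind give the first alternative, in rows of
      different kinds the second; both make the values \<open>max g (1 - g)\<close> agree.\<close>
    if "i < m" "j < c" "i' < m" "j' < c" "g i j = g i' j' \<or> g i j = 1 - g i' j'" for i j i' j'
  proof -
    have "max (g i j) (1 - g i j) = max (g i' j') (1 - g i' j')" using that(5) by auto
    then show ?thesis
      using bij_betw_imp_inj_on[OF bij] that(1-4) by (auto dest!: inj_onD[of _ _ "(i, j)" "(i', j')"])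
  qed
  have z_inj: "inj_on (\<lambda>(u, w). z u w) ((A \<union> B) \<times> W)"
  proof (rule inj_onI, clarify)
    fix u w u' w'
    assume u: "u \<in> A \<union> B" "u' \<in> A \<union> B" and w: "w \<in> W" "w' \<in> W" and eq: "z u w = z u' w'"
    define i where "i v = (if v \<in> A then \<alpha> v else \<beta> v)" for v
    have i_lt: "i u < m" "i u' < m" using u \<alpha>_lt \<beta>_lt unfolding i_def by auto
    have "g (i u) (\<omega> w) = g (i u') (\<omega> w') \<or> g (i u) (\<omega> w) = 1 - g (i u') (\<omega> w')"
      using eq unfolding z_def i_def by (auto split: if_splits)
    then have ij: "i u = i u'" "\<omega> w = \<omega> w'"
      using g_inj i_lt \<omega>_lt w by blast+
    from ij(2) w have "w = w'" using \<omega> by (auto simp: bij_betw_def dest: inj_onD)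
    \<comment> \<open>A label shared by complementary entries would force \<open>g = 1 - g\<close>,
      impossible by parity.\<close>
    moreover have "u \<in> A \<longleftrightarrow> u' \<in> A"
    proof (rule ccontr)
      assume "\<not> (u \<in> A \<longleftrightarrow> u' \<in> A)"
      then have "2 * g (i u) (\<omega> w) = 1"
        using eq ij unfolding z_def i_def by (auto split: if_splits)
      then show False by presburger
    qed
    then have "u = u'"
      using ij(1) u \<alpha> \<beta> unfolding i_def by (auto simp: bij_betw_def dest: inj_onD split: if_splits)
    ultimately show "u = u' \<and> w = w'" by simp
  qed
  define l where "l u w = nat (z u w)" for u w
  have l_int: "int (l u w) = z u w" if "u \<in> A \<union> B" "w \<in> W" for u w
    using z_range[OF that] unfolding l_def by simp
  have "inj_on (\<lambda>(u, w). l u w) ((A \<union> B) \<times> W)"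
  proof (rule inj_on_imageI2)
    show "inj_on (int \<circ> (\<lambda>(u, w). l u w)) ((A \<union> B) \<times> W)"
      using z_inj by (rule inj_on_cong[THEN iffD1, rotated]) (auto simp: l_int)
  qed
  moreover have "(\<lambda>(u, w). l u w) ` ((A \<union> B) \<times> W) \<subseteq> {1..2 * K}"
    using z_range unfolding l_def by fastforce
  moreover have "card ((A \<union> B) \<times> W) = 2 * K"
    using card fin disj by (simp add: card_Un_disjoint card_cartesian_product K_def)
  ultimately have "bij_betw (\<lambda>(u, w). l u w) ((A \<union> B) \<times> W) {1..2 * K}"
    unfolding bij_betw_def by (intro conjI card_subset_eq) (auto simp: card_image)
  moreover have "(\<Sum>w\<in>W. l u w) = K * (2 * n - 1) + n" if "u \<in> A" for u
  proof -
    have "int (\<Sum>w\<in>W. l u w) = (\<Sum>w\<in>W. int K + g (\<alpha> u) (\<omega> w))"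
      using that l_int by (auto simp: z_def intro!: sum.cong)
    also have "\<dots> = (\<Sum>j<c. int K + g (\<alpha> u) j)"
      by (rule sum.reindex_bij_betw[OF \<omega>])
    also have "\<dots> = int (K * c + n)"
      using g[OF \<alpha>_lt[OF that]] by (simp add: sum.distrib)
    finally show ?thesis unfolding c_def by (simp only: of_nat_eq_iff)
  qed
  moreover have "(\<Sum>w\<in>W. l u w) = K * (2 * n - 1) + n - 1" if "u \<in> B" for u
  proof -
    have "u \<notin> A" using that disj by auto
    then have "int (\<Sum>w\<in>W. l u w) = (\<Sum>w\<in>W. int K + 1 - g (\<beta> u) (\<omega> w))"
      using that l_int by (auto simp: z_def intro!: sum.cong)
    also have "\<dots> = (\<Sum>j<c. int K + 1 - g (\<beta> u) j)"
      by (rule sum.reindex_bij_betw[OF \<omega>])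
    also have "\<dots> = int c * (int K + 1) - int n"
      using g[OF \<beta>_lt[OF that]] by (simp add: sum_subtractf)
    also have "\<dots> = int (K * c + n - 1)"
      using c assms(1) by (simp add: algebra_simps of_nat_diff)
    finally show ?thesis unfolding c_def by (simp only: of_nat_eq_iff)
  qed
  moreover have "(\<Sum>u\<in>A \<union> B. l u w) = m * (2 * K + 1)" if "w \<in> W" for w
  proof -
    have "int (\<Sum>u\<in>A \<union> B. l u w) = (\<Sum>u\<in>A. z u w) + (\<Sum>u\<in>B. z u w)"
      using that l_int fin disj by (simp add: sum.union_disjoint)
    also have "(\<Sum>u\<in>A. z u w) = (\<Sum>u\<in>A. int K + g (\<alpha> u) (\<omega> w))"
      by (auto simp: z_def intro!: sum.cong)
    also have "\<dots> = (\<Sum>i<m. int K + g i (\<omega> w))"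
      by (rule sum.reindex_bij_betw[OF \<alpha>])
    also have "(\<Sum>u\<in>B. z u w) = (\<Sum>u\<in>B. int K + 1 - g (\<beta> u) (\<omega> w))"
      using disj by (auto simp: z_def intro!: sum.cong)
    also have "\<dots> = (\<Sum>i<m. int K + 1 - g i (\<omega> w))"
      by (rule sum.reindex_bij_betw[OF \<beta>])
    also have "(\<Sum>i<m. int K + g i (\<omega> w)) + (\<Sum>i<m. int K + 1 - g i (\<omega> w)) = int (m * (2 * K + 1))"
      by (simp add: sum.distrib sum_subtractf algebra_simps)
    finally show ?thesis by (simp only: of_nat_eq_iff)
  qed
  ultimately show ?thesis by blast
qed

section \<open>Labelings of the join with an edgeless graph\<close>

lemma edges_join_edgeless:
  "edges (graph_join G (edgeless W)) = edges G \<union> (\<lambda>(u, w). {u, w}) ` (verts G \<times> W)"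
  by (auto simp: graph_join_def edgeless_def)

lemma verts_join_edgeless: "verts (graph_join G (edgeless W)) = verts G \<union> W"
  by (simp add: graph_join_def edgeless_def)

lemma simple_graph_finite_edges:
  assumes "simple_graph G"
  shows "finite (edges G)"
proof (rule finite_subset)
  show "edges G \<subseteq> Pow (verts G)" "finite (Pow (verts G))"
    using assms unfolding simple_graph_def by auto
qed

text \<open>\<open>G\<close> keeps its labels \<open>1..q\<close> and the join edges receive the
  array entries raised by \<open>q\<close>. Hence each vertex color picks up a row or column sum and
  one \<open>q\<close> per join edge at that vertex.\<close>

lemma join_edgeless_labeling_exists:
  fixes G :: "'a ugraph" and l :: "'a \<Rightarrow> 'a \<Rightarrow> nat"
  assumes simple: "simple_graph G" and W: "finite W" "verts G \<inter> W = {}"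
    and f: "bij_betw f (edges G) {1..q}"
    and l: "bij_betw (\<lambda>(u, w). l u w) (verts G \<times> W) {1..N}"
  defines "J \<equiv> graph_join G (edgeless W)"
  shows "\<exists>F. bij_betw F (edges J) {1..card (edges J)} \<and>
    (\<forall>u\<in>verts G. induced_color J F u = induced_color G f u + (card W * q + (\<Sum>w\<in>W. l u w))) \<and>
    (\<forall>w\<in>W. induced_color J F w = card (verts G) * q + (\<Sum>u\<in>verts G. l u w))"
proof -
  \<comment> \<open>\<open>P\<close> sends a cell of the array to its join edge. Disjointness of
    \<open>verts G\<close> and \<open>W\<close> makes it injective, so the cell can be recovered
    from the edge.\<close>
  define P :: "'a \<times> 'a \<Rightarrow> 'a set" where "P = (\<lambda>(u, w). {u, w})"
  define X where "X = P ` (verts G \<times> W)"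
  define F where "F e = (if e \<in> edges G then f e
    else q + (\<lambda>(u, w). l u w) (the_inv_into (verts G \<times> W) P e))" for e
  have edges: "edges J = edges G \<union> X"
    unfolding J_def X_def P_def by (rule edges_join_edgeless)
  have sub: "e \<subseteq> verts G" if "e \<in> edges G" for e
    using simple that unfolding simple_graph_def by blast
  have fin: "finite (verts G)" "finite (edges G)"
    using simple simple_graph_finite_edges unfolding simple_graph_def by blast+
  have disj: "edges G \<inter> X = {}"
    using sub W(2) unfolding X_def P_def by fastforce
  have inj: "inj_on P (verts G \<times> W)"
    using W(2) unfolding P_def by (intro inj_onI) (auto simp: doubleton_eq_iff)
  have F_old: "F e = f e" if "e \<in> edges G" for e
    using that unfolding F_def by simp
  have F_new: "F {u, w} = q + l u w" if "u \<in> verts G" "w \<in> W" for u w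
  proof -
    have "{u, w} = P (u, w)" "P (u, w) \<in> X" using that unfolding P_def X_def by auto
    moreover from this have "{u, w} \<notin> edges G" using disj by auto
    moreover have "the_inv_into (verts G \<times> W) P (P (u, w)) = (u, w)"
      using inj that by (intro the_inv_into_f_f) auto
    ultimately show ?thesis unfolding F_def by simp
  qed
  have "bij_betw F (edges G) {1..q}"
    using f by (rule bij_betw_cong[THEN iffD1, rotated]) (simp add: F_old)
  moreover have "bij_betw F X {q + 1..q + N}"
  proof -
    have "bij_betw (the_inv_into (verts G \<times> W) P) X (verts G \<times> W)"
      using inj unfolding X_def by (intro bij_betw_the_inv_into) (simp add: bij_betw_def)
    moreover have "bij_betw ((+) q) {1..N} {q + 1..q + N}"
      by (simp add: bij_betw_def)
    ultimately have "bij_betw ((+) q \<circ> ((\<lambda>(u, w). l u w) \<circ> the_inv_into (verts G \<times> W) P)) X {q + 1..q + N}"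
      using l by (blast intro: bij_betw_trans)
    then show ?thesis
      by (rule bij_betw_cong[THEN iffD1, rotated]) (use disj in \<open>auto simp: F_def\<close>)
  qed
  ultimately have "bij_betw F (edges J) ({1..q} \<union> {q + 1..q + N})"
    unfolding edges by (rule bij_betw_combine) auto
  also have "{1..q} \<union> {q + 1..q + N} = {1..q + N}" by auto
  finally have bij: "bij_betw F (edges J) {1..q + N}" .
  then have "card (edges J) = q + N" using bij_betw_same_card by fastforce
  with bij have "bij_betw F (edges J) {1..card (edges J)}" by simp
  moreover have "induced_color J F u = induced_color G f u + (card W * q + (\<Sum>w\<in>W. l u w))"
    if u: "u \<in> verts G" for u
  proof -
    have *: "{e. e \<in> edges J \<and> u \<in> e} = {e. e \<in> edges G \<and> u \<in> e} \<union> (\<lambda>w. {u, w}) ` W"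
      using u W(2) unfolding edges X_def P_def by auto
    have "induced_color J F u = (\<Sum>e | e \<in> edges G \<and> u \<in> e. F e) + (\<Sum>e\<in>(\<lambda>w. {u, w}) ` W. F e)"
      unfolding induced_color_def *
      using disj u fin W by (intro sum.union_disjoint) (auto simp: X_def P_def)
    also have "(\<Sum>e | e \<in> edges G \<and> u \<in> e. F e) = induced_color G f u"
      unfolding induced_color_def by (auto simp: F_old intro: sum.cong)
    also have "(\<Sum>e\<in>(\<lambda>w. {u, w}) ` W. F e) = (\<Sum>w\<in>W. q + l u w)"
      using u by (subst sum.reindex) (auto simp: F_new inj_on_def doubleton_eq_iff)
    finally show ?thesis by (simp add: sum.distrib)
  qed
  moreover have "induced_color J F w = card (verts G) * q + (\<Sum>u\<in>verts G. l u w)"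
    if w: "w \<in> W" for w
  proof -
    have *: "{e. e \<in> edges J \<and> w \<in> e} = (\<lambda>u. {u, w}) ` verts G"
      using w W(2) sub unfolding edges X_def P_def by auto
    have "induced_color J F w = (\<Sum>u\<in>verts G. q + l u w)"
      unfolding induced_color_def * using w
      by (subst sum.reindex) (auto simp: F_new inj_on_def doubleton_eq_iff)
    then show ?thesis by (simp add: sum.distrib)
  qed
  ultimately show ?thesis by blast
qed

section \<open>Lower bound from the chromatic number\<close>

lemma chromatic_number_le_card_colors:
  assumes simple: "simple_graph G"
    and proper: "\<And>u v. {u, v} \<in> edges G \<Longrightarrow> c u \<noteq> (c v :: 'b)"
  shows "chromatic_number G \<le> card (c ` verts G)"
proof -
  obtain h where h: "bij_betw h (c ` verts G) {..<card (c ` verts G)}"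
    using finite_same_card_bij[of "c ` verts G" "{..<card (c ` verts G)}"] simple
    by (auto simp: simple_graph_def)
  have "proper_coloring G (card (c ` verts G)) (h \<circ> c)"
    unfolding proper_coloring_def
  proof (intro conjI allI impI)
    show "(h \<circ> c) ` verts G \<subseteq> {..<card (c ` verts G)}"
      using h by (auto simp: bij_betw_def)
    fix u v assume e: "{u, v} \<in> edges G"
    then have "u \<in> verts G" "v \<in> verts G" using simple unfolding simple_graph_def by auto
    then show "(h \<circ> c) u \<noteq> (h \<circ> c) v"
      using proper[OF e] h by (auto simp: bij_betw_def dest: inj_onD)
  qed
  then show ?thesis unfolding chromatic_number_def by (blast intro: Least_le)
qed

text \<open>Induced colors are a proper coloring, and a vertex of \<open>W\<close> is adjacent to
  all of \<open>G\<close>, so its color is absent from \<open>G\<close>. If there is no labeling,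
  the infimum is infinite and the bound is trivial.\<close>

lemma chi_la_join_edgeless_ge:
  assumes simple: "simple_graph G" and W: "finite W" "W \<noteq> {}"
  shows "enat (chromatic_number G + 1) \<le> chi_la (graph_join G (edgeless W))"
  unfolding chi_la_def
proof (rule INF_greatest, clarify)
  let ?J = "graph_join G (edgeless W)"
  fix F assume F: "local_antimagic_labeling ?J F"
  let ?c = "induced_color ?J F"
  have fin: "finite (verts G)" using simple unfolding simple_graph_def by blast
  have proper: "?c u \<noteq> ?c v" if "{u, v} \<in> edges ?J" for u v
    using F that unfolding local_antimagic_labeling_def by blast
  have "chromatic_number G \<le> card (?c ` verts G)"
    using simple proper by (intro chromatic_number_le_card_colors) (auto simp: edges_join_edgeless)
  moreover obtain w where w: "w \<in> W" using W by blast
  have "?c u \<noteq> ?c w" if "u \<in> verts G" for u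
    using that w by (intro proper) (auto simp: edges_join_edgeless)
  then have "?c w \<notin> ?c ` verts G" by (metis imageE)
  then have "card (insert (?c w) (?c ` verts G)) = card (?c ` verts G) + 1"
    using fin by simp
  moreover have "card (insert (?c w) (?c ` verts G)) \<le> card (induced_colors ?J F)"
    using fin W w unfolding induced_colors_def by (intro card_mono) (auto simp: verts_join_edgeless)
  ultimately show "enat (chromatic_number G + 1) \<le> enat (card (induced_colors ?J F))" by simp
qed

section \<open>Separating the colors of \<open>G\<close> from the color of the new vertices\<close>

text \<open>Among sets of given size, the largest numbers of \<open>1..q\<close> have the greatest
  sum. Doubling avoids a division, and integers avoid truncated subtraction.\<close>

lemma sum_le_top_interval:
  fixes A :: "nat set"
  assumes "A \<subseteq> {1..q}"
  shows "2 * int (\<Sum>A) \<le> int (card A) * (2 * int q + 1 - int (card A))"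
  using assms
proof (induction q arbitrary: A)
  case 0
  then show ?case by simp
next
  case (Suc q)
  have fin: "finite A" using Suc.prems finite_subset by blast
  show ?case
  proof (cases "Suc q \<in> A")
    case True
    have "A - {Suc q} \<subseteq> {1..q}" using Suc.prems by (auto simp: le_Suc_eq)
    note IH = Suc.IH[OF this]
    have "card A = Suc (card (A - {Suc q}))" "\<Sum>A = Suc q + \<Sum>(A - {Suc q})"
      using card.remove[OF fin True] sum.remove[OF fin True, of "\<lambda>x. x"] by (simp_all only:)
    then show ?thesis using IH by (simp add: algebra_simps)
  next
    case False
    then have "A \<subseteq> {1..q}" using Suc.prems by (auto simp: le_Suc_eq)
    from Suc.IH[OF this] show ?thesis by (simp add: algebra_simps)
  qed
qed

text \<open>The witness \<open>d\<close> is the degree of \<open>u\<close>, whose edges carry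
  \<open>d\<close> distinct labels.\<close>

lemma induced_color_bound:
  assumes simple: "simple_graph G" and f: "bij_betw f (edges G) {1..q}" and u: "u \<in> verts G"
  shows "\<exists>d. d \<le> q \<and> d < card (verts G) \<and>
    2 * int (induced_color G f u) \<le> int d * (2 * int q + 1 - int d)"
proof -
  define D where "D = {e. e \<in> edges G \<and> u \<in> e}"
  have fin: "finite (verts G)" "finite (edges G)"
    using simple simple_graph_finite_edges unfolding simple_graph_def by blast+
  have inj: "inj_on f D" using f unfolding D_def bij_betw_def by (auto intro: inj_on_subset)
  have "f ` D \<subseteq> {1..q}" using f unfolding D_def bij_betw_def by auto
  moreover have "card (f ` D) = card D" using inj by (rule card_image)
  moreover have "\<Sum>(f ` D) = induced_color G f u"
    using inj unfolding induced_color_def D_def by (simp add: sum.reindex)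
  ultimately have "2 * int (induced_color G f u) \<le> int (card D) * (2 * int q + 1 - int (card D))"
    using sum_le_top_interval[of "f ` D" q] by simp
  moreover have "card D \<le> q"
    using card_mono[OF fin(2), of D] bij_betw_same_card[OF f] unfolding D_def by auto
  moreover have "card D < card (verts G)"
  proof -
    have "D \<subseteq> (\<lambda>v. {u, v}) ` (verts G - {u})"
    proof
      fix e assume "e \<in> D"
      then have e: "u \<in> e" "e \<subseteq> verts G" "card e = 2"
        using simple unfolding D_def simple_graph_def by auto
      then obtain x y where xy: "e = {x, y}" "x \<noteq> y" unfolding card_2_iff by blast
      then show "e \<in> (\<lambda>v. {u, v}) ` (verts G - {u})"
        using e(1,2) by (auto simp: insert_commute)
    qed
    then have "card D \<le> card (verts G - {u})" using fin by (intro surj_card_le) auto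
    also have "\<dots> < card (verts G)" using fin u by (intro psubset_card_mono) auto
    finally show ?thesis .
  qed
  ultimately show ?thesis by blast
qed

lemma simple_graph_card_edges_le:
  assumes "simple_graph G"
  shows "2 * card (edges G) \<le> card (verts G) * (card (verts G) - 1)"
proof -
  have fin: "finite (verts G)" using assms unfolding simple_graph_def by blast
  have "card (edges G) \<le> card {e. e \<subseteq> verts G \<and> card e = 2}"
    using assms fin unfolding simple_graph_def by (intro card_mono) auto
  also have "\<dots> = card (verts G) choose 2" by (rule n_subsets[OF fin])
  finally show ?thesis by (simp add: choose_two)
qed

text \<open>The left side is the join color of a vertex of \<open>G\<close> with old color
  \<open>x\<close> and degree \<open>d\<close>; the right side is the color of a new vertex. The
  left side is larger in the first case of \<open>iii\<close> and smaller in the second.\<close>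

lemma join_colors_neq:
  fixes m n q d x s K :: int
  assumes "m \<ge> 1" "n \<ge> 2" and iii: "2 * n - 1 > 2 * m \<or> 2 * m \<ge> 2 * n\<^sup>2 - 3 * (n - 1)"
    and q: "0 \<le> q" "q \<le> m * (2 * m - 1)" and d: "d \<le> q" "d < 2 * m"
    and x: "0 \<le> x" "2 * x \<le> d * (2 * q + 1 - d)" and s: "1 \<le> s" "s \<le> n"
    and K: "K = m * (2 * n - 1)"
  shows "x + ((2 * n - 1) * q + (K * (2 * n - 1) + s)) \<noteq> 2 * m * q + m * (2 * K + 1)"
  using iii
proof
  assume "2 * n - 1 > 2 * m"
  then have c: "2 * m + 1 \<le> 2 * n - 1" by simp
  have "m * 1 \<le> K" unfolding K using assms(1,2) by (intro mult_left_mono) auto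
  have "(2 * m + 1) * q \<le> (2 * n - 1) * q" "K * (2 * m + 1) \<le> K * (2 * n - 1)"
    using c q assms(1,2) unfolding K by (auto intro!: mult_right_mono mult_left_mono)
  then show ?thesis
    using \<open>m * 1 \<le> K\<close> x s q by (simp add: algebra_simps)
next
  assume "2 * m \<ge> 2 * n\<^sup>2 - 3 * (n - 1)"
  then have m: "2 * n * n - 3 * n + 3 \<le> 2 * m" by (simp add: power2_eq_square)
  \<comment> \<open>This product is \<open>(2 * n * n - 3 * n + 3) - (4 * n - 3)\<close>.\<close>
  have "0 \<le> (2 * n - 3) * (n - 2)" using assms(2) by simp
  then have mn: "4 * n - 3 \<le> 2 * m" using m by (simp add: algebra_simps)
  have "2 * x + 2 * ((2 * n - 1) * q + (K * (2 * n - 1) + n)) < 2 * (2 * m * q + m * (2 * K + 1))"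
  \<comment> \<open>The bound \<open>d * (2 * q + 1 - d)\<close> grows with \<open>d\<close> up to
    \<open>q\<close>, so its maximum lies at the smaller of \<open>2 * m - 1\<close> and
    \<open>q\<close>. The product introduced in each case is the maximum minus the value at
    \<open>d\<close>.\<close>
  proof (cases "2 * m - 1 \<le> q")
    case True
    have "0 \<le> (2 * m - 1 - d) * (2 * q + 1 - d - (2 * m - 1))"
      using True d by (intro mult_nonneg_nonneg) auto
    then have "2 * x \<le> (2 * m - 1) * (2 * q + 2 - 2 * m)" using x by (simp add: algebra_simps)
    \<comment> \<open>After moving everything to one side, \<open>q\<close> has coefficient
      \<open>4 * n - 4\<close>, so the worst case is the complete graph. What remains is the
      hypothesis scaled by a multiple of \<open>m\<close>, plus slack from
      \<open>mn\<close>.\<close>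
    moreover have "(4 * n - 4) * q \<le> (4 * n - 4) * (m * (2 * m - 1))"
      using q assms(2) by (intro mult_left_mono) auto
    moreover have "2 * m * (2 * n * n - 3 * n + 3) \<le> 2 * m * (2 * m)"
      using m assms(1) by (intro mult_left_mono) auto
    ultimately show ?thesis
      using mn assms(2) unfolding K by (simp add: algebra_simps)
  next
    case False
    have "0 \<le> (q - d) * (q + 1 - d)" "q * (q + 1) \<le> q * (2 * m - 1)"
      using False d q by (auto intro: mult_nonneg_nonneg mult_left_mono)
    then have "2 * x \<le> q * (2 * m - 1)" using x by (simp add: algebra_simps)
    \<comment> \<open>Here the net coefficient of \<open>q\<close> is
      \<open>4 * n - 3 - 2 * m\<close>, which is not positive.\<close>
    moreover have "q * (4 * n - 3) \<le> q * (2 * m)"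
      using mn q by (intro mult_left_mono) auto
    moreover have "0 \<le> K" using assms(1,2) unfolding K by simp
    moreover from this have "K * (2 * n - 1) \<le> K * (2 * m - 1)"
      using mn assms(2) by (intro mult_left_mono) auto
    ultimately show ?thesis
      using mn assms(2) by (simp add: algebra_simps)
  qed
  then show ?thesis using s by simp
qed

section \<open>Upper bound and conclusion\<close>

text \<open>\<open>A\<close> receives the larger row sums, so colors rise by \<open>R + 1\<close> on
  \<open>A\<close> and by \<open>R\<close> on \<open>B\<close>. By \<open>shift\<close> this creates
  no conflict on an edge of \<open>G\<close>; by \<open>sep\<close> the new color depends only on
  the old one, so \<open>G\<close> still shows at most \<open>t\<close> colors.\<close>

lemma chi_la_join_edgeless_le:
  fixes G :: "'a ugraph" and A B W :: "'a set"
  assumes mn: "m \<ge> 1" "n \<ge> 2" and simple: "simple_graph G"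
    and f: "local_antimagic_coloring G t f"
    and AB: "A \<union> B = verts G" "A \<inter> B = {}" "card A = m" "card B = m"
    and sep: "\<And>u v. u \<in> A \<Longrightarrow> v \<in> B \<Longrightarrow> induced_color G f u \<noteq> induced_color G f v"
    and shift: "\<And>u v. u \<in> A \<Longrightarrow> v \<in> B \<Longrightarrow> induced_color G f u + 1 \<noteq> induced_color G f v"
    and iii: "2 * int n - 1 > 2 * int m \<or> 2 * int m \<ge> 2 * (int n)\<^sup>2 - 3 * (int n - 1)"
    and W: "finite W" "card W = 2 * n - 1" "verts G \<inter> W = {}"
  shows "chi_la (graph_join G (edgeless W)) \<le> enat (t + 1)"
proof -
  define q where "q = card (edges G)"
  define K where "K = m * (2 * n - 1)"
  define J where "J = graph_join G (edgeless W)"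
  let ?f = "induced_color G f"
  have f_bij: "bij_betw f (edges G) {1..q}"
    and f_proper: "\<And>u v. {u, v} \<in> edges G \<Longrightarrow> ?f u \<noteq> ?f v"
    and f_card: "card (?f ` verts G) = t"
    using f unfolding local_antimagic_coloring_def local_antimagic_labeling_def
      induced_colors_def q_def by auto
  have fin: "finite (verts G)" using simple unfolding simple_graph_def by blast
  then have fin_AB: "finite A" "finite B" using AB(1) by (auto intro: finite_subset)
  have order: "card (verts G) = 2 * m"
    using card_Un_disjoint[OF fin_AB AB(2)] AB by simp
  obtain l :: "'a \<Rightarrow> 'a \<Rightarrow> nat" where
    l: "bij_betw (\<lambda>(u, w). l u w) (verts G \<times> W) {1..2 * K}"
    and l_A: "\<And>u. u \<in> A \<Longrightarrow> (\<Sum>w\<in>W. l u w) = K * (2 * n - 1) + n"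
    and l_B: "\<And>u. u \<in> B \<Longrightarrow> (\<Sum>w\<in>W. l u w) = K * (2 * n - 1) + n - 1"
    and l_W: "\<And>w. w \<in> W \<Longrightarrow> (\<Sum>u\<in>verts G. l u w) = m * (2 * K + 1)"
    using nearly_magic_rectangle[OF mn(2) fin_AB W(1) AB(3,4) W(2) AB(2)]
    unfolding AB(1) K_def by blast
  obtain F where F_bij: "bij_betw F (edges J) {1..card (edges J)}"
    and F_G: "\<And>u. u \<in> verts G \<Longrightarrow> induced_color J F u = ?f u + (card W * q + (\<Sum>w\<in>W. l u w))"
    and F_W: "\<And>w. w \<in> W \<Longrightarrow> induced_color J F w = card (verts G) * q + (\<Sum>u\<in>verts G. l u w)"
    using join_edgeless_labeling_exists[OF simple W(1,3) f_bij l] unfolding J_def by blast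
  let ?F = "induced_color J F"
  define R where "R = (2 * n - 1) * q + (K * (2 * n - 1) + (n - 1))"
  have F_A: "?F u = ?f u + R + 1" if "u \<in> A" for u
    using F_G[of u] l_A that AB(1) W(2) mn(2) unfolding R_def by auto
  have F_B: "?F u = ?f u + R" if "u \<in> B" for u
    using F_G[of u] l_B that AB(1) W(2) mn(2) unfolding R_def by auto
  have F_const: "?F w = 2 * m * q + m * (2 * K + 1)" if "w \<in> W" for w
    using F_W[OF that] l_W[OF that] order by simp
  have cross: "?F u \<noteq> ?F w" if u: "u \<in> verts G" and w: "w \<in> W" for u w
  proof -
    obtain d where d: "d \<le> q" "d < 2 * m" "2 * int (?f u) \<le> int d * (2 * int q + 1 - int d)"
      using induced_color_bound[OF simple f_bij u] order by auto
    have q: "int q \<le> int m * (2 * int m - 1)"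
    proof -
      have "2 * q \<le> 2 * m * (2 * m - 1)"
        using simple_graph_card_edges_le[OF simple] order unfolding q_def by simp
      then have "q \<le> m * (2 * m - 1)" by simp
      then have "int q \<le> int (m * (2 * m - 1))" by (simp only: of_nat_le_iff)
      then show ?thesis using mn by (simp add: of_nat_diff)
    qed
    have n: "int (2 * n - 1) = 2 * int n - 1" using mn by simp
    \<comment> \<open>The two row sums are \<open>K * (2 * n - 1) + s\<close>, so one numeric lemma
      serves both halves.\<close>
    define s where "s = (if u \<in> A then int n else int n - 1)"
    have s: "1 \<le> s" "s \<le> int n" using mn unfolding s_def by auto
    have "int (?F u) = int (?f u) + int R + (s - (int n - 1))"
      using F_A[of u] F_B[of u] u AB(1) unfolding s_def by auto
    moreover have "int R = (2 * int n - 1) * int q + (int K * (2 * int n - 1) + (int n - 1))"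
      using mn unfolding R_def of_nat_add of_nat_mult n by simp
    ultimately have "int (?F u) = int (?f u) + ((2 * int n - 1) * int q + (int K * (2 * int n - 1) + s))"
      by simp
    moreover have "int (?F w) = 2 * int m * int q + int m * (2 * int K + 1)"
      unfolding F_const[OF w] by (simp add: algebra_simps)
    moreover have "int K = int m * (2 * int n - 1)" unfolding K_def of_nat_mult n ..
    ultimately show ?thesis
      using join_colors_neq[of "int m" "int n" "int q" "int d" "int (?f u)" s "int K"]
        mn iii q d s by auto
  qed
  have inner: "?F u \<noteq> ?F v" if e: "{u, v} \<in> edges G" for u v
  proof -
    have "u \<in> A \<union> B" "v \<in> A \<union> B" using simple e AB(1) unfolding simple_graph_def by auto
    then show ?thesis
      using f_proper[OF e] shift[of u v] shift[of v u] by (auto simp: F_A F_B)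
  qed
  have "?F u \<noteq> ?F v" if e: "{u, v} \<in> edges J" for u v
  proof -
    consider "{u, v} \<in> edges G" | x w where "x \<in> verts G" "w \<in> W" "{u, v} = {x, w}"
      using e unfolding J_def edges_join_edgeless by (elim UnE imageE SigmaE) simp_all
    then show ?thesis
    proof cases
      case 1
      then show ?thesis by (rule inner)
    next
      case 2
      then show ?thesis using cross[of x w] by (auto simp: doubleton_eq_iff)
    qed
  qed
  then have labeling: "local_antimagic_labeling J F"
    using F_bij unfolding local_antimagic_labeling_def by blast
  \<comment> \<open>The recoloring as a function of the old color alone; \<open>sep\<close> ensures
    that a color occurring on \<open>A\<close> never occurs on \<open>B\<close>.\<close>
  define \<phi> where "\<phi> c = (if c \<in> ?f ` A then c + R + 1 else c + R)" for c
  have \<phi>: "?F u = \<phi> (?f u)" if "u \<in> verts G" for u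
    using that AB(1) sep unfolding \<phi>_def by (force simp: F_A F_B)
  have "induced_colors J F \<subseteq> insert (2 * m * q + m * (2 * K + 1)) (\<phi> ` ?f ` verts G)"
    unfolding induced_colors_def J_def[THEN arg_cong[of _ _ verts], unfolded verts_join_edgeless]
    using \<phi> F_const by auto
  then have "card (induced_colors J F) \<le> card (insert (2 * m * q + m * (2 * K + 1)) (\<phi> ` ?f ` verts G))"
    using fin by (intro card_mono) auto
  also have "\<dots> \<le> Suc (card (\<phi> ` ?f ` verts G))" by (rule card_insert_le_m1) auto
  also have "\<dots> \<le> t + 1" using card_image_le[of "?f ` verts G" \<phi>] fin f_card by simp
  finally have "enat (card (induced_colors J F)) \<le> enat (t + 1)" by simp
  moreover have "chi_la J \<le> enat (card (induced_colors J F))"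
    using labeling unfolding chi_la_def by (intro INF_lower) simp
  ultimately show ?thesis unfolding J_def by (rule order_trans[rotated])
qed

theorem theorem3p12:
  fixes G :: "'a ugraph" and W V1 V2 :: "'a set" and C1 C2 :: "'a set set"
    and f :: "'a set \<Rightarrow> nat" and m n t :: nat
  assumes "m \<ge> 2" and "n \<ge> 2" and "t \<ge> 3"
    and "simple_graph G" and "card (verts G) = 2 * m"
    and "local_antimagic_coloring G t f"
    and "C1 \<union> C2 = color_classes G f" and "C1 \<inter> C2 = {}"
    and "V1 = \<Union> C1" and "V2 = \<Union> C2"
    and "card V1 = m" and "card V2 = m"
    and "\<not> (\<exists>a b :: int.
            a \<in> (\<lambda>v. int (induced_color G f v)) ` V1 \<and>
            b + 1 \<in> (\<lambda>v. int (induced_color G f v)) ` V1 \<and>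
            a + 1 \<in> (\<lambda>v. int (induced_color G f v)) ` V2 \<and>
            b \<in> (\<lambda>v. int (induced_color G f v)) ` V2)"
    and "2 * real n - 1 > 2 * real m \<or> real m \<ge> (real n)\<^sup>2 - 3 * (real n - 1) / 2"
    and "finite W" and "card W = 2 * n - 1" and "verts G \<inter> W = {}"
  shows "chi_la (graph_join G (edgeless W)) \<le> enat (t + 1) \<and>
    (chromatic_number G = t \<longrightarrow> chi_la (graph_join G (edgeless W)) = enat (t + 1))"
proof -
  let ?f = "induced_color G f"
  have fin: "finite (verts G)" using \<open>simple_graph G\<close> unfolding simple_graph_def by blast
  \<comment> \<open>\<open>V1\<close> is a union of whole color classes, so it contains every vertex
    whose color it meets.\<close>
  have class_V1: "v \<in> V1" if "u \<in> V1" "v \<in> verts G" "?f u = ?f v" for u v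
  proof -
    obtain C where C: "C \<in> C1" "u \<in> C" using \<open>u \<in> V1\<close> assms(9) by blast
    then obtain c where "C = color_class G f c" using assms(7) unfolding color_classes_def by blast
    then have "v \<in> C" using C(2) that(2,3) unfolding color_class_def by simp
    then show ?thesis using C(1) assms(9) by blast
  qed
  have V: "V1 \<union> V2 = verts G"
  proof -
    have "V1 \<union> V2 = \<Union> (color_classes G f)" using assms(7,9,10) by blast
    then show ?thesis by (auto simp: color_classes_def color_class_def induced_colors_def)
  qed
  then have "finite V1" "finite V2" using fin by (auto intro: finite_subset)
  \<comment> \<open>By counting: the union has \<open>2 * m\<close> elements, the sum of the two
    sizes.\<close>
  then have disj: "V1 \<inter> V2 = {}"
    using card_Un_Int[of V1 V2] V assms(5,11,12) by simp
  have sep: "?f u \<noteq> ?f v" if "u \<in> V1" "v \<in> V2" for u v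
    using class_V1[of u v] that V disj by auto
  have iii: "2 * int n - 1 > 2 * int m \<or> 2 * int m \<ge> 2 * (int n)\<^sup>2 - 3 * (int n - 1)"
    using assms(14)
  proof
    assume "2 * real n - 1 > 2 * real m"
    then have "2 * int n - 1 > 2 * int m" by linarith
    then show ?thesis ..
  next
    assume "real m \<ge> (real n)\<^sup>2 - 3 * (real n - 1) / 2"
    then have "real_of_int (2 * int m) \<ge> real_of_int (2 * (int n)\<^sup>2 - 3 * (int n - 1))"
      by (simp add: field_simps)
    then have "2 * int m \<ge> 2 * (int n)\<^sup>2 - 3 * (int n - 1)" by (simp only: of_int_le_iff)
    then show ?thesis ..
  qed
  note le = chi_la_join_edgeless_le[OF _ \<open>n \<ge> 2\<close> \<open>simple_graph G\<close> assms(6) _ _ _ _ _ _ iii assms(15-17)]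
  \<comment> \<open>If both orientations failed, \<open>a = ?f u\<close> and
    \<open>b = ?f u'\<close> would violate condition (ii). The side that works becomes
    \<open>A\<close>.\<close>
  have shift: "(\<forall>u\<in>V1. \<forall>v\<in>V2. ?f u + 1 \<noteq> ?f v) \<or> (\<forall>u\<in>V2. \<forall>v\<in>V1. ?f u + 1 \<noteq> ?f v)"
  proof (rule ccontr)
    assume "\<not> ?thesis"
    then obtain u v u' v' where uv: "u \<in> V1" "v \<in> V2" "?f u + 1 = ?f v" "u' \<in> V2" "v' \<in> V1" "?f u' + 1 = ?f v'"
      by blast
    then have "int (?f u) + 1 = int (?f v)" "int (?f u') + 1 = int (?f v')" by linarith+
    with uv assms(13) show False by (metis imageI)
  qed
  have upper: "chi_la (graph_join G (edgeless W)) \<le> enat (t + 1)"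
    using shift
  proof
    assume "\<forall>u\<in>V1. \<forall>v\<in>V2. ?f u + 1 \<noteq> ?f v"
    then show ?thesis using le[of V1 V2] V disj sep assms(1,11,12) by auto
  next
    assume "\<forall>u\<in>V2. \<forall>v\<in>V1. ?f u + 1 \<noteq> ?f v"
    moreover have "?f v \<noteq> ?f u" if "u \<in> V1" "v \<in> V2" for u v using sep[OF that] by simp
    ultimately show ?thesis using le[of V2 V1] V disj assms(1,11,12) by (auto simp: Un_commute Int_commute)
  qed
  have "W \<noteq> {}" using assms(2,16) by auto
  then have "enat (chromatic_number G + 1) \<le> chi_la (graph_join G (edgeless W))"
    using chi_la_join_edgeless_ge \<open>simple_graph G\<close> \<open>finite W\<close> by blast
  with upper show ?thesis by (auto intro: antisym)
qed

end
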